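(* Let $m\ge 1$ and $n\ge 0$ be integers and $x$ a real number. Let $M=\lceil m/2\rceil-1$. Then \begin{align*} E_n\!\left(\frac{x}{m+1}\right)&=\frac{1}{(m+1)^n}\sum_{k=0}^{\infty}\frac{(m+1)^k}{2^{2k+m}}\sum_{n_1,\dots,n_M=0}^{k}\binom{k}{n_1,\dots,n_M}(-1)^{\sum_{j\ \mathrm{odd}} n_j}\,\frac{4^{n_1+\cdots+n_M}}{(m+1)^{n_1+\cdots+n_M}}\\ &\qquad\times\prod_{j=1}^{M}\left(\frac{\binom{m-j-1}{j}}{2^{2j+1}}+\frac{\binom{m-j-1}{j+1}}{2^{2j+2}}\right)^{n_j}\\ &\qquad\times E_n^{(2k+2n_1+4n_2+\cdots+2Mn_M+m+1)}\big(k+n_1+2n_2+\cdots+Mn_M+x\big), \end{align*} where $(-1)^{\sum_{j\ \mathrm{odd}}n_j}=(-1)^{n_1+n_3+\cdots+n_{M'}}$ with $M'$ the largest odd number $\le M$ (empty sums/products, e.g. when $M=0$, are $0$/$1$ respectively).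
   Context: Higher-order Euler polynomials $E_n^{(p)}(x)$ are defined by $\left(\frac{2}{e^t+1}\right)^p e^{xt}=\sum_{n\ge 0}E_n^{(p)}(x)\frac{t^n}{n!}$, and $E_n(x)=E_n^{(1)}(x)$. Binomial coefficients $\binom{a}{b}$ are $0$ if $b>a$ or $b<0$. The multinomial coefficient is $\binom{k}{n_1,\dots,n_M}=\frac{k!}{n_1!\cdots n_M!\,(k-n_1-\cdots-n_M)!}$ when $n_1+\cdots+n_M\le k$, and $0$ otherwise. *)

theory Defs
  imports Complex_Main "HOL-Library.FuncSet" "HOL-Computational_Algebra.Formal_Power_Series"
begin

definition euler_gen :: "nat \<Rightarrow> real \<Rightarrow> real fps" where
  "euler_gen p x = (2 / (fps_exp 1 + 1)) ^ p * fps_exp x"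

text \<open>The value at \<open>x\<close> of the order-\<open>p\<close> Euler polynomial of degree \<open>n\<close>.\<close>

definition euler_poly_order :: "nat \<Rightarrow> nat \<Rightarrow> real \<Rightarrow> real" where
  "euler_poly_order p n x = fact n * fps_nth (euler_gen p x) n"

definition euler_poly :: "nat \<Rightarrow> real \<Rightarrow> real" where
  "euler_poly n x = euler_poly_order 1 n x"

lemma euler_gen_eq:
  "(2 / (fps_exp 1 + 1)) ^ p * fps_exp x = Abs_fps (\<lambda>n. euler_poly_order p n x / fact n)"
  by (rule fps_ext) (simp add: euler_poly_order_def euler_gen_def)

lemma euler_gen_mult:
  "(fps_exp 1 + 1) ^ p * euler_gen p x = 2 ^ p * fps_exp x"
proof -
  have "fps_nth (fps_exp 1 + 1 :: real fps) 0 \<noteq> 0"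
    by simp
  then have "(fps_exp 1 + 1) * (2 / (fps_exp 1 + 1)) = (2 :: real fps)"
    by (simp add: fps_divide_unit inverse_mult_eq_1' mult.left_commute)
  then show ?thesis
    by (simp add: euler_gen_def mult.assoc[symmetric] power_mult_distrib[symmetric])
qed

text \<open>The lower entries are \<open>\<nu> 1, \<dots>, \<nu> M\<close>; the slack \<open>k - (\<nu> 1 + \<dots> + \<nu> M)\<close> is an implicit
  further entry, so for \<open>M = 1\<close> this is an ordinary binomial coefficient.\<close>

definition multinomial :: "nat \<Rightarrow> nat \<Rightarrow> (nat \<Rightarrow> nat) \<Rightarrow> real" where
  "multinomial k M \<nu> =
     (if (\<Sum>j=1..M. \<nu> j) \<le> k
      then fact k / ((\<Prod>j=1..M. fact (\<nu> j)) * fact (k - (\<Sum>j=1..M. \<nu> j)))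
      else 0)"

end

theory Submission
  imports Defs
begin

text \<open>With \<open>y = exp t\<close> and \<open>u = 4 * y / (1 + y)\<^sup>2\<close>, Girard's formula for the power sums of
  \<open>1 / (1 + y)\<close> and \<open>y / (1 + y)\<close> gives \<open>1 + y ^ (m + 1) = (1 + y) ^ (m + 1) * (1 - P u)\<close> for a
  polynomial \<open>P\<close>. The generating function of the left-hand side is \<open>2 / (1 + y ^ (m + 1)) * y ^ x\<close>,
  so it becomes \<open>(2 / (1 + y)) ^ (m + 1) * y ^ x / 2 ^ m\<close> times the geometric series of \<open>P u\<close>,
  whose powers expand by the multinomial theorem. Since \<open>u = 1\<close> at \<open>t = 0\<close>, the constant term
  of \<open>P u\<close> is \<open>1 - 1 / 2 ^ m\<close>; as it lies in \<open>[0, 1)\<close>, each coefficient of the geometric series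
  converges.\<close>

section \<open>Geometric series of formal power series\<close>

text \<open>The triangle inequality, summed over \<open>k < K\<close>, bounds
  \<open>1 - \<bar>c\<bar>\<close> times each partial sum by a number independent of
  \<open>K\<close>.\<close>

lemma summable_abs_linear_recurrence:
  fixes a b :: "nat \<Rightarrow> real"
  assumes rec: "\<And>k. a (Suc k) = c * a k + b k"
    and c: "\<bar>c\<bar> < 1" and b: "summable (\<lambda>k. \<bar>b k\<bar>)"
  shows "summable (\<lambda>k. \<bar>a k\<bar>)"
proof (rule summableI_nonneg_bounded[where x = "(\<bar>a 0\<bar> + (\<Sum>k. \<bar>b k\<bar>)) / (1 - \<bar>c\<bar>)"])
  fix K
  have "(\<Sum>k<K. \<bar>a k\<bar>) \<le> (\<Sum>k<Suc K. \<bar>a k\<bar>)"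
    by simp
  also have "\<dots> = \<bar>a 0\<bar> + (\<Sum>k<K. \<bar>a (Suc k)\<bar>)"
    by (rule sum.lessThan_Suc_shift)
  also have "(\<Sum>k<K. \<bar>a (Suc k)\<bar>) \<le> (\<Sum>k<K. \<bar>c\<bar> * \<bar>a k\<bar> + \<bar>b k\<bar>)"
    by (intro sum_mono) (simp add: rec flip: abs_mult)
  also have "\<dots> = \<bar>c\<bar> * (\<Sum>k<K. \<bar>a k\<bar>) + (\<Sum>k<K. \<bar>b k\<bar>)"
    by (simp add: sum.distrib sum_distrib_left)
  also have "(\<Sum>k<K. \<bar>b k\<bar>) \<le> (\<Sum>k. \<bar>b k\<bar>)"
    using b by (intro sum_le_suminf) auto
  finally have "(1 - \<bar>c\<bar>) * (\<Sum>k<K. \<bar>a k\<bar>) \<le> \<bar>a 0\<bar> + (\<Sum>k. \<bar>b k\<bar>)"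
    by (simp add: algebra_simps)
  then show "(\<Sum>k<K. \<bar>a k\<bar>) \<le> (\<bar>a 0\<bar> + (\<Sum>k. \<bar>b k\<bar>)) / (1 - \<bar>c\<bar>)"
    using c by (simp add: field_simps)
qed simp

text \<open>Writing \<open>P\<close> as its constant term plus \<open>fps_X * Q\<close> gives
  coefficient \<open>Suc n\<close> a linear recurrence in \<open>k\<close> whose inhomogeneous part
  is coefficient \<open>n\<close> with \<open>A * Q\<close> in place of \<open>A\<close>. Hence the
  induction keeps \<open>A\<close> arbitrary.\<close>

lemma summable_abs_fps_mult_power_nth:
  fixes A P :: "real fps"
  assumes "\<bar>fps_nth P 0\<bar> < 1"
  shows "summable (\<lambda>k. \<bar>fps_nth (A * P ^ k) n\<bar>)"
proof (induction n arbitrary: A)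
  case 0
  have "\<bar>fps_nth (A * P ^ k) 0\<bar> = \<bar>fps_nth A 0\<bar> * \<bar>fps_nth P 0\<bar> ^ k" for k
    by (simp add: abs_mult power_abs fps_nth_power_0)
  then show ?case
    using assms by (simp add: summable_mult summable_geometric)
next
  case (Suc n)
  define Q where "Q = fps_shift 1 P"
  have P: "P = fps_const (fps_nth P 0) + fps_X * Q"
    by (rule fps_ext) (auto simp: Q_def)
  have "A * P ^ Suc k = fps_const (fps_nth P 0) * (A * P ^ k) + fps_X * ((A * Q) * P ^ k)" for k
  proof -
    have "A * P ^ Suc k = P * (A * P ^ k)"
      by simp
    also have "\<dots> = (fps_const (fps_nth P 0) + fps_X * Q) * (A * P ^ k)"
      using P by simp
    finally show ?thesis
      by (simp add: algebra_simps)
  qed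
  then show ?case
    by (intro summable_abs_linear_recurrence[OF _ assms Suc.IH[of "A * Q"]]) simp
qed

text \<open>The constant term of \<open>P\<close> may be nonzero, so convergence is real convergence
  of each coefficient. The partial sums telescope to \<open>B - B * P ^ K\<close>, whose remainder
  tends to 0 by the summability above.\<close>

lemma sums_fps_geometric_nth:
  fixes A B P :: "real fps"
  assumes "\<bar>fps_nth P 0\<bar> < 1" and B: "B * (1 - P) = A"
  shows "(\<lambda>k. fps_nth (A * P ^ k) n) sums fps_nth B n"
proof -
  have partial: "(\<Sum>k<K. A * P ^ k) = B - B * P ^ K" for K
  proof -
    have "(\<Sum>k<K. A * P ^ k) = B * ((1 - P) * (\<Sum>k<K. P ^ k))"
      by (simp add: sum_distrib_left mult.assoc flip: B)
    also have "\<dots> = B - B * P ^ K"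
      by (simp only: one_diff_power_eq[symmetric] right_diff_distrib mult_1_right)
    finally show ?thesis .
  qed
  have "(\<lambda>K. fps_nth (B * P ^ K) n) \<longlonglongrightarrow> 0"
    using assms(1)
    by (intro summable_LIMSEQ_zero summable_rabs_cancel[OF summable_abs_fps_mult_power_nth])
  then have "(\<lambda>K. fps_nth B n - fps_nth (B * P ^ K) n) \<longlonglongrightarrow> fps_nth B n - 0"
    by (intro tendsto_intros)
  moreover have "(\<Sum>k<K. fps_nth (A * P ^ k) n) = fps_nth B n - fps_nth (B * P ^ K) n" for K
    by (simp add: partial flip: fps_sum_nth)
  ultimately show ?thesis
    by (simp add: sums_def)
qed

section \<open>The multinomial theorem\<close>

text \<open>Placing the \<open>i\<close> copies of the last entry first leaves a multinomial choice
  among \<open>k - i\<close> places; for \<open>i > k\<close> both sides vanish. This drives the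
  induction on \<open>M\<close> below.\<close>

lemma multinomial_Suc:
  "multinomial k (Suc M) (\<nu>(Suc M := i)) = real (k choose i) * multinomial (k - i) M \<nu>"
proof -
  have s: "(\<Sum>j=1..M. (\<nu>(Suc M := i)) j) = (\<Sum>j=1..M. \<nu> j)"
    by (rule sum.cong) auto
  have p: "(\<Prod>j=1..M. fact ((\<nu>(Suc M := i)) j)) = (\<Prod>j=1..M. fact (\<nu> j) :: real)"
    by (rule prod.cong) auto
  show ?thesis
  proof (cases "i \<le> k")
    case True
    have slack: "(S + i \<le> k) = (S \<le> k - i)" "k - (S + i) = k - i - S" for S
      using True by auto
    have s': "(\<Sum>j=1..Suc M. (\<nu>(Suc M := i)) j) = (\<Sum>j=1..M. \<nu> j) + i"
      using s by simp
    have p': "(\<Prod>j=1..Suc M. fact ((\<nu>(Suc M := i)) j)) = (\<Prod>j=1..M. fact (\<nu> j) :: real) * fact i"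
      using p by simp
    show ?thesis
      unfolding multinomial_def s' p' slack using True by (simp add: binomial_fact)
  next
    case False
    then show ?thesis
      using s by (simp add: multinomial_def)
  qed
qed

text \<open>The range \<open>{0..K}\<close> may exceed \<open>k\<close> because the extra multinomial coefficients vanish; this
  keeps the index set fixed in the induction.\<close>

lemma fps_multinomial_theorem:
  fixes z :: "nat \<Rightarrow> real fps"
  assumes "k \<le> K"
  shows "(1 + (\<Sum>j=1..M. z j)) ^ k =
    (\<Sum>\<nu> \<in> {1..M} \<rightarrow>\<^sub>E {0..K}. fps_const (multinomial k M \<nu>) * (\<Prod>j=1..M. z j ^ \<nu> j))"
  using assms
proof (induction M arbitrary: k)
  case 0
  then show ?case
    by (simp add: multinomial_def)
next
  case (Suc M)
  let ?F = "{1..M} \<rightarrow>\<^sub>E {0..K}"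
  have "(1 + (\<Sum>j=1..Suc M. z j)) ^ k = (z (Suc M) + (1 + (\<Sum>j=1..M. z j))) ^ k"
    by (simp add: algebra_simps)
  also have "\<dots> = (\<Sum>i\<le>k. of_nat (k choose i) * z (Suc M) ^ i * (1 + (\<Sum>j=1..M. z j)) ^ (k - i))"
    by (rule binomial_ring)
  also have "\<dots> = (\<Sum>i=0..K. of_nat (k choose i) * z (Suc M) ^ i * (1 + (\<Sum>j=1..M. z j)) ^ (k - i))"
    using Suc.prems by (intro sum.mono_neutral_left) auto
  also have "\<dots> = (\<Sum>i=0..K. \<Sum>\<nu>\<in>?F. fps_const (multinomial k (Suc M) (\<nu>(Suc M := i))) *
      (\<Prod>j=1..Suc M. z j ^ (\<nu>(Suc M := i)) j))"
  proof (rule sum.cong[OF refl])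
    fix i
    have p: "(\<Prod>j=1..M. z j ^ (\<nu>(Suc M := i)) j) = (\<Prod>j=1..M. z j ^ \<nu> j)" for \<nu>
      by (rule prod.cong) auto
    have IH: "(1 + (\<Sum>j=1..M. z j)) ^ (k - i) =
        (\<Sum>\<nu>\<in>?F. fps_const (multinomial (k - i) M \<nu>) * (\<Prod>j=1..M. z j ^ \<nu> j))"
      using Suc.prems by (intro Suc.IH) simp
    show "of_nat (k choose i) * z (Suc M) ^ i * (1 + (\<Sum>j=1..M. z j)) ^ (k - i) =
      (\<Sum>\<nu>\<in>?F. fps_const (multinomial k (Suc M) (\<nu>(Suc M := i))) *
        (\<Prod>j=1..Suc M. z j ^ (\<nu>(Suc M := i)) j))"
      unfolding IH sum_distrib_left multinomial_Suc fps_const_mult[symmetric] fps_of_nat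
      using p by (intro sum.cong refl) (simp add: mult_ac del: fps_const_mult)
  qed
  also have "\<dots> = (\<Sum>(i, \<nu>) \<in> {0..K} \<times> ?F. fps_const (multinomial k (Suc M) (\<nu>(Suc M := i))) *
      (\<Prod>j=1..Suc M. z j ^ (\<nu>(Suc M := i)) j))"
    by (rule sum.cartesian_product)
  \<comment> \<open>All functions in \<open>?F\<close> take the same default value at
    \<open>Suc M\<close>, so updating there loses nothing and is injective on the pairs.\<close>
  also have "\<dots> = (\<Sum>\<nu> \<in> (\<lambda>(i, \<nu>). \<nu>(Suc M := i)) ` ({0..K} \<times> ?F).
      fps_const (multinomial k (Suc M) \<nu>) * (\<Prod>j=1..Suc M. z j ^ \<nu> j))"
    by (subst sum.reindex[OF inj_combinator]) (simp_all add: case_prod_unfold)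
  also have "(\<lambda>(i, \<nu>). \<nu>(Suc M := i)) ` ({0..K} \<times> ?F) = {1..Suc M} \<rightarrow>\<^sub>E {0..K}"
    by (simp add: atLeastAtMostSuc_conv PiE_insert_eq)
  finally show ?case .
qed

section \<open>Power sums of two elements with sum one\<close>

text \<open>Pascal's rule for both binomials: the coefficient form of
  \<open>s (r + 2) = s (r + 1) - a * b * s r\<close> for the power sums
  \<open>s r = a ^ r + b ^ r\<close> with \<open>a + b = 1\<close>.\<close>

lemma girard_coeff_Suc_Suc:
  fixes m j :: nat
  assumes "m \<ge> 1"
  shows "2 * (m - j choose (j + 1)) + (m - j choose (j + 2)) =
    2 * (m - j - 1 choose (j + 1)) + (m - j - 1 choose (j + 2)) +
    (2 * (m - j - 1 choose j) + (m - j - 1 choose (j + 1)))"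
proof (cases "m - j")
  case 0
  then show ?thesis
    using assms by (cases j) auto
qed auto

text \<open>Two-step induction by the recurrence of power sums; multiplying by \<open>a * b\<close>
  shifts the index, so the sum for \<open>m\<close> is taken with an upper limit one smaller.
  Coefficients vanish once \<open>2 * j \<ge> m\<close>, so \<open>m \<le> 2 * M + 2\<close> keeps
  all nonzero terms.\<close>

lemma power_sum_two:
  fixes a b :: "'a :: comm_ring_1"
  assumes "a + b = 1" and "m \<ge> 1" and "m \<le> 2 * M + 2"
  shows "a ^ (m + 1) + b ^ (m + 1) = 1 - (\<Sum>j=0..M. (- 1) ^ j *
    of_nat (2 * (m - j - 1 choose j) + (m - j - 1 choose (j + 1))) * (a * b) ^ (j + 1))"
proof -
  define d where "d m j = 2 * (m - j - 1 choose j) + (m - j - 1 choose (j + 1))" for m j :: nat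
  define S where "S m M = (\<Sum>j=0..M. (- 1) ^ j * of_nat (d m j) * (a * b) ^ (j + 1))" for m M
  have b: "b = 1 - a"
    using assms(1) by (simp add: algebra_simps)
  have d_1: "d (Suc 0) j = (if j = 0 then 2 else 0)" for j
    by (cases j) (auto simp: d_def)
  have d_2: "d (Suc (Suc 0)) j = (if j = 0 then 3 else 0)" for j
    by (cases j) (auto simp: d_def)
  have d_0: "d (Suc (Suc m)) 0 = d (Suc m) 0 + 1" for m
    by (simp add: d_def)
  have d_Suc: "d (Suc (Suc m)) (Suc j) = d (Suc m) (Suc j) + d m j" if "m \<ge> 1" for m j
    using girard_coeff_Suc_Suc[OF that, of j] by (simp add: d_def)
  have "a ^ Suc m + b ^ Suc m = 1 - S m M"
    using assms(2,3)
  proof (induction m arbitrary: M rule: induct_nat_012)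
    case 0
    then show ?case by simp
  next
    case 1
    have "S (Suc 0) M = (\<Sum>j\<in>{0::nat}. 2 * (a * b))"
      unfolding S_def by (rule sum.mono_neutral_cong_right) (auto simp: d_1 split: if_splits)
    then show ?case
      by (simp add: b algebra_simps)
  next
    case (ge2 m)
    show ?case
    \<comment> \<open>The induction hypothesis for \<open>m\<close> itself requires
      \<open>m \<ge> 1\<close>, so the sum of cubes is computed directly.\<close>
    proof (cases "m = 0")
      case True
      have "S (Suc (Suc 0)) M = (\<Sum>j\<in>{0::nat}. 3 * (a * b))"
        unfolding S_def by (rule sum.mono_neutral_cong_right) (auto simp: d_2 split: if_splits)
      with True show ?thesis
        by (simp add: b algebra_simps)
    next
      case False
      then obtain M' where M: "M = Suc M'"
        using ge2.prems by (cases M) auto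
      have IH1: "a ^ Suc m + b ^ Suc m = 1 - S m M'"
        using False ge2.prems M by (intro ge2.IH) auto
      have IH2: "a ^ Suc (Suc m) + b ^ Suc (Suc m) = 1 - S (Suc m) M"
        using ge2.prems by (intro ge2.IH) auto
      have "(- 1) ^ Suc j * of_nat (d (Suc (Suc m)) (Suc j)) * (a * b) ^ (Suc j + 1) =
          (- 1) ^ Suc j * of_nat (d (Suc m) (Suc j)) * (a * b) ^ (Suc j + 1) -
          a * b * ((- 1) ^ j * of_nat (d m j) * (a * b) ^ (j + 1))" for j
        using False by (simp add: d_Suc algebra_simps)
      then have "S (Suc (Suc m)) M = S (Suc m) M + a * b * (1 - S m M')"
        unfolding M S_def sum.atLeast0_atMost_Suc_shift o_def d_0
        by (simp only: sum_subtractf sum_distrib_left[symmetric]) (simp add: algebra_simps)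
      moreover have "a ^ Suc (Suc (Suc m)) + b ^ Suc (Suc (Suc m)) =
          (a + b) * (a ^ Suc (Suc m) + b ^ Suc (Suc m)) - a * b * (a ^ Suc m + b ^ Suc m)"
        by (simp add: algebra_simps)
      ultimately show ?thesis
        unfolding IH1 IH2 assms(1) by simp
    qed
  qed
  then show ?thesis
    by (simp only: S_def d_def Suc_eq_plus1)
qed

section \<open>Generating functions of Euler polynomials\<close>

lemma fps_const_prod: "fps_const (prod f A) = (\<Prod>j\<in>A. fps_const (f j))"
  by (induction A rule: infinite_finite_induct) (simp_all flip: fps_const_mult)

text \<open>Each factor \<open>4 * y / (1 + y)^2\<close> with \<open>y = fps_exp 1\<close> raises
  the order by 2 and the argument by 1; thus powers of it are absorbed into Euler
  polynomials.\<close>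

lemma euler_gen_add:
  "euler_gen (2 * r + p) (real r + y) = ((2 / (fps_exp 1 + 1))\<^sup>2 * fps_exp 1) ^ r * euler_gen p y"
proof -
  have "fps_exp (real r + y) = fps_exp 1 ^ r * fps_exp y"
    by (simp add: fps_exp_power_mult fps_exp_add_mult)
  moreover have "g ^ (2 * r + p) = g\<^sup>2 ^ r * g ^ p" for g :: "real fps"
    by (simp only: power_add power_mult)
  ultimately show ?thesis
    by (simp only: euler_gen_def power_mult_distrib mult_ac)
qed

text \<open>Replacing \<open>t\<close> by \<open>c * t\<close> gives the generating function of
  \<open>c ^ n * euler_poly n (x / c)\<close>, here with its denominator cleared.\<close>

lemma euler_gen_compose_linear:
  assumes "c \<noteq> 0"
  shows "(fps_exp c + 1) * (euler_gen 1 (x / c) oo (fps_const c * fps_X)) = 2 * fps_exp x"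
proof -
  have "(fps_exp c + 1) * (euler_gen 1 (x / c) oo (fps_const c * fps_X)) =
      ((fps_exp 1 + 1) ^ 1 * euler_gen 1 (x / c)) oo (fps_const c * fps_X)"
    by (simp add: fps_compose_mult_distrib fps_compose_add_distrib)
  also have "\<dots> = (2 * fps_exp (x / c)) oo (fps_const c * fps_X)"
    by (simp only: euler_gen_mult) simp
  also have "\<dots> = 2 * fps_exp x"
    using assms by (simp add: fps_compose_mult_distrib numeral_fps_const)
  finally show ?thesis .
qed

text \<open>Here \<open>4 * y / (1 + y)\<^sup>2 = u\<close> for \<open>y = fps_exp 1\<close>, so this is the power sum formula for
  \<open>1 / (1 + y)\<close> and \<open>y / (1 + y)\<close>, multiplied by \<open>(1 + y) ^ (m + 1)\<close>.\<close>

lemma fps_exp_power_sum: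
  fixes m M :: nat
  defines "u \<equiv> (2 / (fps_exp 1 + 1))\<^sup>2 * fps_exp 1 :: real fps"
  assumes "m \<ge> 1" and "m \<le> 2 * M + 2"
  shows "(fps_exp 1 + 1) ^ (m + 1) * (1 - (\<Sum>j=0..M. fps_const ((- 1) ^ j *
      (real (m - j - 1 choose j) / 2 ^ (2 * j + 1) +
       real (m - j - 1 choose (j + 1)) / 2 ^ (2 * j + 2))) * u ^ (j + 1))) =
    fps_exp (real m + 1) + 1"
proof -
  define a :: "real fps" where "a = inverse (fps_exp 1 + 1)"
  define b where "b = fps_exp 1 * a"
  have a: "(fps_exp 1 + 1) * a = 1"
    unfolding a_def by (intro inverse_mult_eq_1') simp
  have "a + b = 1"
    using a by (simp add: b_def algebra_simps)
  have g: "2 / (fps_exp 1 + 1) = 2 * a"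
    by (simp add: a_def fps_divide_unit)
  have u: "u = fps_const 4 * (a * b)"
    unfolding u_def g b_def by (simp add: power2_eq_square mult_ac flip: numeral_fps_const)
  have coeff: "fps_const ((- 1) ^ j * (real (m - j - 1 choose j) / 2 ^ (2 * j + 1) +
       real (m - j - 1 choose (j + 1)) / 2 ^ (2 * j + 2))) * u ^ (j + 1) =
      (- 1) ^ j * of_nat (2 * (m - j - 1 choose j) + (m - j - 1 choose (j + 1))) * (a * b) ^ (j + 1)"
    for j
  proof -
    let ?d = "2 * (m - j - 1 choose j) + (m - j - 1 choose (j + 1))"
    let ?c = "real (m - j - 1 choose j) / 2 ^ (2 * j + 1) +
       real (m - j - 1 choose (j + 1)) / 2 ^ (2 * j + 2)"
    \<comment> \<open>Since \<open>u = 4 * (a * b)\<close>, the power \<open>u ^ (j + 1)\<close>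
      supplies \<open>4 ^ (j + 1) = 2 ^ (2 * j + 2)\<close>, which clears the denominators of
      \<open>?c\<close>.\<close>
    have "(2 :: real) ^ (2 * j) = 4 ^ j"
      unfolding power_mult by simp
    then have "?c * 4 ^ (j + 1) = real ?d"
      by (simp add: power_add field_simps del: binomial_Suc_Suc)
    then have "(- 1) ^ j * ?c * 4 ^ (j + 1) = (- 1) ^ j * real ?d"
      by (simp only: mult.assoc)
    moreover have "(- 1) ^ j = (fps_const ((- 1) ^ j) :: real fps)"
      by (cases "even j") (simp_all flip: fps_const_neg)
    ultimately show ?thesis
      unfolding u power_mult_distrib fps_const_power mult.assoc[symmetric] fps_const_mult
      by (simp only: fps_of_nat[symmetric] fps_const_mult)
  qed
  have "fps_exp (real m + 1) + 1 = fps_exp 1 ^ (m + 1) + (1 :: real fps)"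
    by (simp only: fps_exp_power_mult) (simp add: algebra_simps)
  also have "\<dots> = (fps_exp 1 + 1) ^ (m + 1) * (a ^ (m + 1) + b ^ (m + 1))"
  proof -
    have "(fps_exp 1 + 1) ^ (m + 1) * a ^ (m + 1) = 1"
      by (simp only: power_mult_distrib[symmetric] a power_one)
    then show ?thesis
      unfolding b_def power_mult_distrib
      by (simp only: distrib_left mult.left_commute[of _ "fps_exp 1 ^ (m + 1)"])
        (simp only: mult_1_right add.commute)
  qed
  finally show ?thesis
    unfolding power_sum_two[OF \<open>a + b = 1\<close> assms(2,3)] coeff by simp
qed

section \<open>Series expansion of Euler polynomials at a scaled argument\<close>

theorem theorem5p5:
  fixes m n M :: nat and x :: real
  assumes "m \<ge> 1"
    and "int M = \<lceil>real m / 2\<rceil> - 1"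
  shows "let term = (\<lambda>k::nat.
           (real m + 1) ^ k / 2 ^ (2 * k + m) *
           (\<Sum>\<nu> \<in> {1..M} \<rightarrow>\<^sub>E {0..k}.
              multinomial k M \<nu> *
              (- 1) ^ (\<Sum>j | j \<in> {1..M} \<and> odd j. \<nu> j) *
              (4 ^ (\<Sum>j=1..M. \<nu> j) / (real m + 1) ^ (\<Sum>j=1..M. \<nu> j)) *
              (\<Prod>j=1..M. (real ((m - j - 1) choose j) / 2 ^ (2 * j + 1)
                        + real ((m - j - 1) choose (j + 1)) / 2 ^ (2 * j + 2)) ^ \<nu> j) *
              euler_poly_order (2 * k + (\<Sum>j=1..M. 2 * j * \<nu> j) + m + 1) n
                (real k + real (\<Sum>j=1..M. j * \<nu> j) + x)))
         in summable term \<and>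
            euler_poly n (x / (real m + 1)) = 1 / (real m + 1) ^ n * (\<Sum>k. term k)"
proof -
  define N where "N = real m + 1"
  define c where "c j = real (m - j - 1 choose j) / 2 ^ (2 * j + 1) +
      real (m - j - 1 choose (j + 1)) / 2 ^ (2 * j + 2)" for j
  define u :: "real fps" where "u = (2 / (fps_exp 1 + 1))\<^sup>2 * fps_exp 1"
  define P where "P = (\<Sum>j=0..M. fps_const ((- 1) ^ j * c j) * u ^ (j + 1))"
  define A where "A = fps_const (1 / 2 ^ m) * euler_gen (m + 1) x"
  define B where "B = euler_gen 1 (x / N) oo (fps_const N * fps_X)"
  \<comment> \<open>The \<open>j = 0\<close> term of \<open>P\<close> is \<open>N / 4 * u\<close>,
    as \<open>c 0 = 1 / 2 + (m - 1) / 4\<close>. Dividing it out leaves \<open>1\<close> plus the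
    sum of the \<open>z j\<close>, the form expanded by the multinomial theorem.\<close>
  define z where "z j = fps_const ((- 1) ^ j * (4 / N) * c j) * u ^ j" for j
  define T where "T = (\<lambda>k. N ^ k / 2 ^ (2 * k + m) *
           (\<Sum>\<nu> \<in> {1..M} \<rightarrow>\<^sub>E {0..k}.
              multinomial k M \<nu> *
              (- 1) ^ (\<Sum>j | j \<in> {1..M} \<and> odd j. \<nu> j) *
              (4 ^ (\<Sum>j=1..M. \<nu> j) / N ^ (\<Sum>j=1..M. \<nu> j)) *
              (\<Prod>j=1..M. c j ^ \<nu> j) *
              euler_poly_order (2 * k + (\<Sum>j=1..M. 2 * j * \<nu> j) + m + 1) n
                (real k + real (\<Sum>j=1..M. j * \<nu> j) + x)))"
  have N: "N > 0" "N \<noteq> 0"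
    by (auto simp: N_def)
  \<comment> \<open>The ceiling gives \<open>M + 1 \<ge> m / 2\<close>.\<close>
  have "m \<le> 2 * M + 2"
    using assms(2) by linarith
  with assms(1) have exp_N: "(fps_exp 1 + 1) ^ (m + 1) * (1 - P) = fps_exp N + 1"
    unfolding P_def c_def u_def N_def by (rule fps_exp_power_sum)

  \<comment> \<open>Compare constant terms: \<open>fps_exp 1 + 1\<close> and
    \<open>fps_exp N + 1\<close> both start with 2.\<close>
  have "2 ^ (m + 1) * (1 - fps_nth P 0) = 2"
    using arg_cong[OF exp_N, of "\<lambda>f. fps_nth f 0"] by (simp add: fps_nth_power_0)
  then have "fps_nth P 0 = 1 - 1 / 2 ^ m"
    by (simp add: field_simps)
  moreover have "0 < 1 / (2::real) ^ m" "1 / (2::real) ^ m \<le> 1"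
    by simp_all
  ultimately have P0: "\<bar>fps_nth P 0\<bar> < 1"
    by linarith

  have B: "B * (1 - P) = A"
  proof -
    \<comment> \<open>The two sides are compared after multiplication by \<open>?F\<close>, which
      cancels because its constant term is nonzero.\<close>
    let ?F = "(fps_exp 1 + 1 :: real fps) ^ (m + 1)"
    have "?F * (B * (1 - P)) = (fps_exp N + 1) * B"
      by (simp only: exp_N[symmetric] mult_ac)
    also have "\<dots> = 2 * fps_exp x"
      unfolding B_def using N by (intro euler_gen_compose_linear) simp
    also have "\<dots> = fps_const (1 / 2 ^ m) * (2 ^ (m + 1) * fps_exp x)"
    proof -
      have "fps_const (1 / 2 ^ m) * 2 ^ (m + 1) = (2 :: real fps)"
        by (simp add: numeral_fps_const)
      then show ?thesis
        by (simp only: mult.assoc[symmetric])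
    qed
    also have "\<dots> = ?F * A"
      unfolding A_def euler_gen_mult[symmetric] by (simp only: mult_ac)
    finally have "?F * (B * (1 - P)) = ?F * A" .
    moreover have "?F \<noteq> 0"
    proof -
      have "fps_nth ?F 0 \<noteq> 0"
        by (simp only: fps_nth_power_0) simp
      then show ?thesis
        by (metis fps_zero_nth)
    qed
    ultimately show ?thesis
      by simp
  qed

  have P: "P = fps_const (N / 4) * u * (1 + (\<Sum>j=1..M. z j))"
  proof -
    have c0: "c 0 = N / 4"
      using assms(1) by (simp add: c_def N_def field_simps of_nat_diff)
    have "P = fps_const (N / 4) * u + (\<Sum>j=1..M. fps_const ((- 1) ^ j * c j) * u ^ (j + 1))"
      by (simp add: P_def sum.atLeast_Suc_atMost c0)
    moreover have "fps_const ((- 1) ^ j * c j) * u ^ (j + 1) = fps_const (N / 4) * u * z j" for j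
    proof -
      have "(N / 4) * ((- 1) ^ j * (4 / N) * c j) = (- 1) ^ j * c j"
        using N by simp
      then have "fps_const ((- 1) ^ j * c j) = fps_const (N / 4) * fps_const ((- 1) ^ j * (4 / N) * c j)"
        by (simp only: fps_const_mult)
      then show ?thesis
        by (simp only: z_def power_add power_one_right mult_ac)
    qed
    ultimately show ?thesis
      by (simp only: distrib_left sum_distrib_left mult_1_right)
  qed

  have T: "T k = fact n * fps_nth (A * P ^ k) n" for k
  proof -
    let ?F = "{1..M} \<rightarrow>\<^sub>E {0..k}"
    let ?s = "\<lambda>\<nu>. \<Sum>j=1..M. \<nu> j" and ?w = "\<lambda>\<nu>. \<Sum>j=1..M. j * \<nu> j"
    let ?q = "\<lambda>\<nu>. (- 1) ^ (\<Sum>j | j \<in> {1..M} \<and> odd j. \<nu> j) *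
        (4 ^ ?s \<nu> / N ^ ?s \<nu>) * (\<Prod>j=1..M. c j ^ \<nu> j)"
    have sign: "(\<Prod>j=1..M. ((- 1) ^ j) ^ \<nu> j) = (- 1 :: real) ^ (\<Sum>j | j \<in> {1..M} \<and> odd j. \<nu> j)" for \<nu>
    proof -
      have "(\<Prod>j=1..M. ((- 1 :: real) ^ j) ^ \<nu> j) = (\<Prod>j=1..M. if odd j then (- 1) ^ \<nu> j else 1)"
        by (intro prod.cong refl) auto
      also have "\<dots> = (\<Prod>j | j \<in> {1..M} \<and> odd j. (- 1) ^ \<nu> j)"
        by (rule prod.inter_filter[symmetric]) simp
      finally show ?thesis
        by (simp add: power_sum)
    qed
    have z: "(\<Prod>j=1..M. z j ^ \<nu> j) = fps_const (?q \<nu>) * u ^ ?w \<nu>" for \<nu>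
    proof -
      have "(\<Prod>j=1..M. z j ^ \<nu> j) =
          (\<Prod>j=1..M. fps_const (((- 1) ^ j * (4 / N) * c j) ^ \<nu> j) * u ^ (j * \<nu> j))"
        by (intro prod.cong refl) (simp only: z_def power_mult_distrib fps_const_power power_mult)
      also have "\<dots> = fps_const (\<Prod>j=1..M. ((- 1) ^ j * (4 / N) * c j) ^ \<nu> j) * u ^ ?w \<nu>"
        by (simp only: prod.distrib fps_const_prod power_sum)
      also have "(\<Prod>j=1..M. ((- 1) ^ j * (4 / N) * c j) ^ \<nu> j) = ?q \<nu>"
        by (simp only: power_mult_distrib prod.distrib sign power_sum[symmetric] flip: power_divide)
      finally show ?thesis .
    qed
    \<comment> \<open>The exponent \<open>k + ?w \<nu>\<close> collects \<open>u ^ k\<close> from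
      the factor \<open>N / 4 * u\<close> of \<open>P\<close> and \<open>u ^ ?w \<nu>\<close> from
      the \<open>z j\<close>.\<close>
    have gen: "euler_gen (2 * k + (\<Sum>j=1..M. 2 * j * \<nu> j) + m + 1) (real k + real (?w \<nu>) + x) =
        u ^ (k + ?w \<nu>) * euler_gen (m + 1) x" for \<nu>
    proof -
      have "2 * k + (\<Sum>j=1..M. 2 * j * \<nu> j) + m + 1 = 2 * (k + ?w \<nu>) + (m + 1)"
        by (simp only: sum_distrib_left distrib_left mult.assoc add.assoc)
      then show ?thesis
        by (simp only: u_def euler_gen_add of_nat_add[symmetric])
    qed
    let ?E = "\<lambda>\<nu>. euler_gen (2 * k + (\<Sum>j=1..M. 2 * j * \<nu> j) + m + 1) (real k + real (?w \<nu>) + x)"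
    have "A * P ^ k = fps_const (1 / 2 ^ m) * fps_const ((N / 4) ^ k) *
        ((1 + (\<Sum>j=1..M. z j)) ^ k * (u ^ k * euler_gen (m + 1) x))"
      unfolding A_def P power_mult_distrib fps_const_power by (simp only: mult_ac)
    moreover have "(1 + (\<Sum>j=1..M. z j)) ^ k * (u ^ k * euler_gen (m + 1) x) =
        (\<Sum>\<nu>\<in>?F. fps_const (multinomial k M \<nu> * ?q \<nu>) * ?E \<nu>)"
      unfolding fps_multinomial_theorem[OF order_refl] sum_distrib_right
    proof (rule sum.cong[OF refl])
      fix \<nu>
      show "fps_const (multinomial k M \<nu>) * (\<Prod>j=1..M. z j ^ \<nu> j) * (u ^ k * euler_gen (m + 1) x) =
          fps_const (multinomial k M \<nu> * ?q \<nu>) * ?E \<nu>"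
        unfolding z gen power_add by (simp only: fps_const_mult[symmetric] mult_ac)
    qed
    moreover have "1 / 2 ^ m * (N / 4) ^ k = N ^ k / 2 ^ (2 * k + m)"
      unfolding power_add power_mult power_divide by simp
    ultimately have "A * P ^ k = fps_const (N ^ k / 2 ^ (2 * k + m)) *
        (\<Sum>\<nu>\<in>?F. fps_const (multinomial k M \<nu> * ?q \<nu>) * ?E \<nu>)"
      by (simp only: fps_const_mult)
    then have "fact n * fps_nth (A * P ^ k) n = fact n * (N ^ k / 2 ^ (2 * k + m) *
        (\<Sum>\<nu>\<in>?F. multinomial k M \<nu> * ?q \<nu> * fps_nth (?E \<nu>) n))"
      by (simp only: fps_mult_left_const_nth fps_sum_nth)
    also have "\<dots> = T k"
      unfolding T_def euler_poly_order_def sum_distrib_left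
      by (simp only: mult_ac)
    finally show ?thesis
      by (rule sym)
  qed

  have "T sums (fact n * fps_nth B n)"
    using sums_mult[OF sums_fps_geometric_nth[OF P0 B]] by (simp only: T[abs_def])
  \<comment> \<open>Composition with \<open>fps_const N * fps_X\<close> scales coefficient
    \<open>n\<close> by \<open>N ^ n\<close>, the source of the prefactor.\<close>
  moreover have "fact n * fps_nth B n = N ^ n * euler_poly n (x / N)"
    by (simp add: B_def fps_compose_linear euler_poly_def euler_poly_order_def)
  ultimately have "summable T \<and> euler_poly n (x / N) = 1 / N ^ n * (\<Sum>k. T k)"
    using N by (simp add: sums_iff)
  then show ?thesis
    unfolding T_def N_def c_def by (simp only: Let_def)
qed

end
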